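(* Let $n>1$ be an integer, let $m\ge 0$ be an integer, and let $\tilde c_0\neq 0$ be a given real number. Consider the vector of polynomials ${\bm \phi}(x)=[\phi_0(x)\;\phi_1(x)\;\cdots\;\phi_m(x)]^T$ in the paravector variable $x=x_0+\underline{x}\in\mathcal{A}_n$ given by $${\bm \phi}(x)=e^{Hx_0}\,D_{\tilde c}\,{\bm \xi}(\underline{x}),$$ where $D_{\tilde c}=\mathrm{diag}[\tilde c_0\;\tilde c_1\;\cdots\;\tilde c_m]$ has real entries, ${\bm \xi}(\underline{x})=[1\;\underline{x}\;\underline{x}^2\;\cdots\;\underline{x}^m]^T$, and $H$ is the $(m+1)\times(m+1)$ matrix with entries $(H)_{ij}=i$ if $i=j+1$ and $(H)_{ij}=0$ otherwise, $i,j=0,1,\dots,m$; equivalently, $$\phi_k(x)=\sum_{j=0}^{k}\binom{k}{j}\,\tilde c_j\,\underline{x}^{j}\,x_0^{k-j},\qquad k=0,1,\dots,m .$$ If the remaining coefficients satisfy $$\tilde c_{2k}=\tilde c_{2k-1}=\frac{(2k-1)!!\,(n-2)!!}{(n+2k-2)!!}\,\tilde c_0,\qquad k=1,2,\dots$$ (for all indices occurring among $1,\dots,m$), then the polynomials $\phi_0,\phi_1,\dots,\phi_m$ are monogenic, i.e. $\overline{\partial}\phi_k=0$ for every $k=0,1,\dots,m$.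
   Context: Let $\{e_1,\dots,e_n\}$ be an orthonormal basis of $\mathbb{R}^n$ with the non-commutative product determined by $e_ie_j+e_je_i=-2\delta_{ij}$, $i,j=1,\dots,n$. The associative $2^n$-dimensional real Clifford algebra $\mathcal{C}\ell_{0,n}$ has basis $\{e_A: A\subseteq\{1,\dots,n\}\}$, where $e_A=e_{h_1}\cdots e_{h_r}$ for $A=\{h_1<\dots<h_r\}$ and $e_\emptyset=e_0=1$. The space $\mathbb{R}^{n+1}$ is identified with $\mathcal{A}_n=\mathrm{span}_{\mathbb{R}}\{1,e_1,\dots,e_n\}\subset\mathcal{C}\ell_{0,n}$: the element $(x_0,x_1,\dots,x_n)$ is identified with the paravector $x=x_0+\underline{x}$, where $\underline{x}=\sum_{k=1}^n e_kx_k$. Powers $\underline{x}^j$ are taken in $\mathcal{C}\ell_{0,n}$, with $\underline{x}^0=1$. The generalized Cauchy-Riemann operator is $\overline{\partial}=\frac12(\partial_0+\partial_{\underline{x}})$, with $\partial_0=\frac{\partial}{\partial x_0}$ and $\partial_{\underline{x}}=\sum_{k=1}^n e_k\frac{\partial}{\partial x_k}$ (the $e_k$ multiply from the left). A $\mathcal{C}\ell_{0,n}$-valued function $f$ is called (left) monogenic if $\overline{\partial}f=0$. The double factorial is the usual one: $N!!=N(N-2)(N-4)\cdots$ down to $1$ or $2$, with $0!!=1$. *)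

theory Defs
  imports "HOL-Analysis.Analysis" "Jordan_Normal_Form.Matrix"
begin

text \<open>
  Both imports use \<open>$\<close> for components: \<open>$h\<close> is the one for \<open>real ^ 'n\<close>, \<open>$v\<close> the one for
  the zero-based vectors whose dimension is a natural number.
\<close>

no_notation vec_nth (infixl "$" 90) and vec_index (infixl "$" 100)
notation vec_nth (infixl "$h" 90) and vec_index (infixl "$v" 100)

section \<open>The Clifford algebra with $n$ negative generators\<close>

text \<open>
  The generators are indexed by a finite linearly ordered type \<open>'n\<close> in the role of
  $\{1 < \dots < n\}$, so $n$ is \<open>CARD('n)\<close>. An element is the family of its $2^n$ real
  coefficients with respect to the basis $(e_A)$, where $A$ ranges over all sets of indices.
\<close>

typedef 'n clifford = "UNIV :: (real ^ ('n::finite set)) set"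
  morphisms coeffs Clifford by simp

setup_lifting type_definition_clifford

lemma clifford_eq_iff: "x = y \<longleftrightarrow> coeffs x = coeffs y"
  by (simp add: coeffs_inject)

subsection \<open>Euclidean structure\<close>

instantiation clifford :: (finite) real_inner
begin

lift_definition zero_clifford :: "'a clifford" is 0 .
lift_definition plus_clifford :: "'a clifford \<Rightarrow> 'a clifford \<Rightarrow> 'a clifford" is "(+)" .
lift_definition minus_clifford :: "'a clifford \<Rightarrow> 'a clifford \<Rightarrow> 'a clifford" is "(-)" .
lift_definition uminus_clifford :: "'a clifford \<Rightarrow> 'a clifford" is uminus .
lift_definition scaleR_clifford :: "real \<Rightarrow> 'a clifford \<Rightarrow> 'a clifford" is scaleR .
lift_definition inner_clifford :: "'a clifford \<Rightarrow> 'a clifford \<Rightarrow> real" is inner .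
lift_definition norm_clifford :: "'a clifford \<Rightarrow> real" is norm .

definition dist_clifford :: "'a clifford \<Rightarrow> 'a clifford \<Rightarrow> real" where
  "dist_clifford x y = norm (x - y)"

definition sgn_clifford :: "'a clifford \<Rightarrow> 'a clifford" where
  "sgn_clifford x = inverse (norm x) *\<^sub>R x"

definition uniformity_clifford :: "('a clifford \<times> 'a clifford) filter" where
  "uniformity_clifford = (INF e\<in>{0<..}. principal {(x, y). dist x y < e})"

definition open_clifford :: "'a clifford set \<Rightarrow> bool" where
  "open_clifford U \<longleftrightarrow> (\<forall>x\<in>U. \<forall>\<^sub>F (x', y) in uniformity. x' = x \<longrightarrow> y \<in> U)"

instance
proof
  fix x y z :: "'a clifford" and r s :: real and U :: "'a clifford set"
  show "x + y + z = x + (y + z)" by transfer (rule add.assoc)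
  show "x + y = y + x" by transfer (rule add.commute)
  show "0 + x = x" by transfer simp
  show "- x + x = 0" by transfer simp
  show "x - y = x + - y" by transfer simp
  show "r *\<^sub>R (x + y) = r *\<^sub>R x + r *\<^sub>R y" by transfer (rule scaleR_add_right)
  show "(r + s) *\<^sub>R x = r *\<^sub>R x + s *\<^sub>R x" by transfer (rule scaleR_add_left)
  show "r *\<^sub>R s *\<^sub>R x = (r * s) *\<^sub>R x" by transfer simp
  show "1 *\<^sub>R x = x" by transfer simp
  show "dist x y = norm (x - y)" by (rule dist_clifford_def)
  show "sgn x = inverse (norm x) *\<^sub>R x" by (rule sgn_clifford_def)
  show "uniformity = (INF e\<in>{0<..}. principal {(x, y :: 'a clifford). dist x y < e})"
    by (rule uniformity_clifford_def)
  show "open U \<longleftrightarrow> (\<forall>x\<in>U. \<forall>\<^sub>F (x', y) in uniformity. x' = x \<longrightarrow> y \<in> U)"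
    by (rule open_clifford_def)
  show "inner x y = inner y x" by transfer (rule inner_commute)
  show "inner (x + y) z = inner x z + inner y z" by transfer (rule inner_add_left)
  show "inner (r *\<^sub>R x) y = r * inner x y" by transfer simp
  show "0 \<le> inner x x" by transfer simp
  show "inner x x = 0 \<longleftrightarrow> x = 0" by transfer simp
  show "norm x = sqrt (inner x x)" by transfer (rule norm_eq_sqrt_inner)
qed

end

lemma coeffs_sum: "coeffs (sum f S) = (\<Sum>i\<in>S. coeffs (f i))"
  by (induction S rule: infinite_finite_induct) (simp_all add: zero_clifford.rep_eq plus_clifford.rep_eq)

instantiation clifford :: (finite) euclidean_space
begin

lift_definition Basis_clifford :: "'a clifford set" is Basis .

instance
proof
  fix x u v :: "'a clifford"
  show "(Basis :: 'a clifford set) \<noteq> {}" by transfer simp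
  show "finite (Basis :: 'a clifford set)" by transfer simp
  show "u \<in> Basis \<Longrightarrow> v \<in> Basis \<Longrightarrow> inner u v = (if u = v then 1 else 0)"
    by transfer (rule inner_Basis)
  show "(\<forall>u\<in>Basis. inner x u = 0) \<longleftrightarrow> x = 0"
    by transfer (rule euclidean_all_zero_iff)
qed

end

lemma DIM_clifford: "DIM('n::finite clifford) = 2 ^ CARD('n)"
proof -
  have "DIM('n clifford) = DIM(real ^ 'n set)"
    by transfer simp
  then show ?thesis by (simp add: card_Pow flip: Pow_UNIV)
qed

subsection \<open>Product\<close>

lift_definition blade :: "'n::finite set \<Rightarrow> 'n clifford" is "\<lambda>A. axis A 1" .

text \<open>
  Sorting $e_A e_B$ takes one transposition for every pair $b < a$ with $a \in A$, $b \in B$;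
  afterwards every common index contributes a factor $e_a^2 = -1$, and these are the pairs with
  $b = a$.
\<close>

definition blade_sign :: "'n::{finite,linorder} set \<Rightarrow> 'n set \<Rightarrow> real" where
  "blade_sign A B = (- 1) ^ card {(a, b). a \<in> A \<and> b \<in> B \<and> b \<le> a}"

instantiation clifford :: ("{finite,linorder}") "{one,times}"
begin

definition one_clifford :: "'a clifford" where
  "one_clifford = blade {}"

definition times_clifford :: "'a clifford \<Rightarrow> 'a clifford \<Rightarrow> 'a clifford" where
  "times_clifford x y = (\<Sum>A\<in>UNIV. \<Sum>B\<in>UNIV.
     (coeffs x $h A * coeffs y $h B * blade_sign A B) *\<^sub>R blade (sym_diff A B))"

instance ..

end

lemma clifford_expand: "x = (\<Sum>A\<in>UNIV. (coeffs x $h A) *\<^sub>R blade A)"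
  by (simp add: clifford_eq_iff coeffs_sum scaleR_clifford.rep_eq blade.rep_eq
      Finite_Cartesian_Product.vec_eq_iff axis_def if_distrib[of "\<lambda>t. _ * t"] cong: if_cong)

lemma clifford_linear_left: "linear (\<lambda>x::'n::{finite,linorder} clifford. x * y)"
  by (rule linearI)
    (simp_all add: times_clifford_def plus_clifford.rep_eq scaleR_clifford.rep_eq algebra_simps
      sum.distrib scaleR_sum_right)

lemma clifford_linear_right: "linear (\<lambda>y::'n::{finite,linorder} clifford. x * y)"
  by (rule linearI)
    (simp_all add: times_clifford_def plus_clifford.rep_eq scaleR_clifford.rep_eq algebra_simps
      sum.distrib scaleR_sum_right)

lemma blade_times_blade: "blade A * blade B = blade_sign A B *\<^sub>R blade (sym_diff A B)"
proof -
  have "(\<Sum>C\<in>UNIV. \<Sum>D\<in>UNIV. (coeffs (blade A) $h C * coeffs (blade B) $h D * blade_sign C D)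
           *\<^sub>R blade (sym_diff C D)) =
        (\<Sum>C\<in>UNIV. \<Sum>D\<in>UNIV. if C = A \<and> D = B then
           blade_sign A B *\<^sub>R blade (sym_diff A B) else 0)"
    by (intro sum.cong refl) (auto simp: blade.rep_eq axis_def)
  also have "\<dots> = (\<Sum>C\<in>UNIV. if C = A then blade_sign A B *\<^sub>R blade (sym_diff A B) else 0)"
    by (intro sum.cong refl) auto
  finally show ?thesis by (simp add: times_clifford_def)
qed

lemma blade_sign_prod:
  "blade_sign A B = (\<Prod>a\<in>UNIV. \<Prod>b\<in>UNIV. if a \<in> A \<and> b \<in> B \<and> b \<le> a then - 1 else 1)"
proof -
  have "(\<Prod>a\<in>UNIV. \<Prod>b\<in>UNIV. if a \<in> A \<and> b \<in> B \<and> b \<le> a then - 1 else 1 :: real) =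
        (\<Prod>p\<in>UNIV. if p \<in> {(a, b). a \<in> A \<and> b \<in> B \<and> b \<le> a} then - 1 else 1)"
    unfolding prod.cartesian_product by (rule prod.cong) (auto split: if_splits)
  also have "\<dots> = (\<Prod>p\<in>{(a, b). a \<in> A \<and> b \<in> B \<and> b \<le> a}. - 1)"
    by (subst prod.If_cases) auto
  finally show ?thesis by (simp add: blade_sign_def)
qed

lemma blade_sign_sym_diff_right: "blade_sign A (sym_diff B C) = blade_sign A B * blade_sign A C"
  unfolding blade_sign_prod prod.distrib[symmetric] by (intro prod.cong refl) auto

lemma blade_sign_sym_diff_left: "blade_sign (sym_diff A B) C = blade_sign A C * blade_sign B C"
  unfolding blade_sign_prod prod.distrib[symmetric] by (intro prod.cong refl) auto

lemma blade_assoc: "blade A * blade B * blade C = blade A * (blade B * blade C)"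
proof -
  have "sym_diff (sym_diff A B) C = sym_diff A (sym_diff B C)" by auto
  then show ?thesis
    by (simp only: blade_times_blade linear_scale[OF clifford_linear_left]
        linear_scale[OF clifford_linear_right] blade_sign_sym_diff_left blade_sign_sym_diff_right
        scaleR_scaleR mult_ac)
qed

lemma clifford_linear_eqI:
  fixes f g :: "'n::finite clifford \<Rightarrow> 'b::real_vector"
  assumes "linear f" "linear g" "\<And>A. f (blade A) = g (blade A)"
  shows "f x = g x"
  by (subst (1 2) clifford_expand[of x])
    (simp add: linear_sum[OF assms(1)] linear_sum[OF assms(2)] linear_scale[OF assms(1)]
      linear_scale[OF assms(2)] assms(3))

instance clifford :: ("{finite,linorder}") real_algebra_1
proof
  fix x y z :: "'a clifford" and r :: real
  note lin = clifford_linear_left clifford_linear_right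
    linear_compose[unfolded o_def, OF clifford_linear_left clifford_linear_left]
    linear_compose[unfolded o_def, OF clifford_linear_left clifford_linear_right]
    linear_compose[unfolded o_def, OF clifford_linear_right clifford_linear_left]
    linear_compose[unfolded o_def, OF clifford_linear_right clifford_linear_right]
  show "(x + y) * z = x * z + y * z" by (rule linear_add[OF clifford_linear_left])
  show "x * (y + z) = x * y + x * z" by (rule linear_add[OF clifford_linear_right])
  show "r *\<^sub>R x * y = r *\<^sub>R (x * y)" by (rule linear_scale[OF clifford_linear_left])
  show "x * r *\<^sub>R y = r *\<^sub>R (x * y)" by (rule linear_scale[OF clifford_linear_right])
  show "x * y * z = x * (y * z)"
  proof (rule clifford_linear_eqI[of "\<lambda>x. x * y * z" "\<lambda>x. x * (y * z)" x])
    fix A show "blade A * y * z = blade A * (y * z)"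
    proof (rule clifford_linear_eqI[of "\<lambda>y. blade A * y * z" "\<lambda>y. blade A * (y * z)" y])
      fix B show "blade A * blade B * z = blade A * (blade B * z)"
        by (rule clifford_linear_eqI[of "\<lambda>z. blade A * blade B * z"
              "\<lambda>z. blade A * (blade B * z)" z]) (simp_all only: lin blade_assoc)
    qed (simp_all only: lin)
  qed (simp_all only: lin)
  show "1 * x = x"
    by (rule clifford_linear_eqI[of "\<lambda>x. 1 * x" "\<lambda>x. x" x])
      (simp_all add: lin linear_id[unfolded id_def] one_clifford_def blade_times_blade blade_sign_def)
  show "x * 1 = x"
    by (rule clifford_linear_eqI[of "\<lambda>x. x * 1" "\<lambda>x. x" x])
      (simp_all add: lin linear_id[unfolded id_def] one_clifford_def blade_times_blade blade_sign_def)
  show "(0 :: 'a clifford) \<noteq> 1"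
    by (simp add: one_clifford_def clifford_eq_iff zero_clifford.rep_eq blade.rep_eq)
qed

definition gen :: "'n::finite \<Rightarrow> 'n clifford" where
  "gen k = blade {k}"

lemma gen_anticommute:
  fixes i j :: "'n::{finite,linorder}"
  shows "gen i * gen j + gen j * gen i = (if i = j then - 2 else 0)"
proof -
  have s: "blade_sign {a} {b} = (if b \<le> a then - 1 else 1)" for a b :: 'n
  proof -
    have "{(a', b'). a' \<in> {a} \<and> b' \<in> {b} \<and> b' \<le> a'} = (if b \<le> a then {(a, b)} else {})" by auto
    then show ?thesis by (simp add: blade_sign_def)
  qed
  show ?thesis
  proof (cases "i = j")
    case True
    then show ?thesis
      by (simp add: gen_def blade_times_blade s flip: one_clifford_def)
  next
    case False
    then have "sym_diff {i} {j} = sym_diff {j} {i}" by auto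
    with False show ?thesis
      by (cases i j rule: linorder_cases) (auto simp: gen_def blade_times_blade s)
  qed
qed

lemma blade_eq_prod_gen:
  fixes A :: "'n::{finite,linorder} set"
  shows "blade A = prod_list (map gen (sorted_list_of_set A))"
proof -
  have "finite A" by simp
  then show ?thesis
  proof (induction A rule: finite_linorder_min_induct)
    case empty
    then show ?case by (simp add: one_clifford_def)
  next
    case (insert b A)
    then have "insort b (sorted_list_of_set A) = b # sorted_list_of_set A"
      by (intro insort_is_Cons) (auto simp: less_imp_le)
    moreover have "b \<notin> A" using insert.hyps by auto
    moreover have "{(a', b'). a' \<in> {b} \<and> b' \<in> A \<and> b' \<le> a'} = {}"
      using insert.hyps by force
    then have "blade_sign {b} A = 1" by (simp only: blade_sign_def) simp
    moreover have "sym_diff {b} A = insert b A" using \<open>b \<notin> A\<close> by auto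
    ultimately show ?case
      using insert.IH[symmetric] insert.hyps by (simp add: gen_def blade_times_blade)
  qed
qed

section \<open>Monogenic functions\<close>

text \<open>
  The space $\mathbb{R}^{n+1}$: the point \<open>(x\<^sub>0, v)\<close> stands for the paravector
  $x_0 + \underline{x}$ with $\underline{x}$ = \<open>vector_part v\<close>.
\<close>

type_synonym 'n paravector = "real \<times> (real, 'n) Finite_Cartesian_Product.vec"

definition vector_part :: "real ^ 'n \<Rightarrow> 'n::finite clifford" where
  "vector_part v = (\<Sum>k\<in>UNIV. (v $h k) *\<^sub>R gen k)"

definition partial_derivative ::
    "('a::real_normed_vector \<Rightarrow> 'b::real_normed_vector) \<Rightarrow> 'a \<Rightarrow> 'a \<Rightarrow> 'b" where
  "partial_derivative f v p = vector_derivative (\<lambda>t. f (p + t *\<^sub>R v)) (at 0)"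

definition cauchy_riemann ::
    "('n paravector \<Rightarrow> 'n clifford) \<Rightarrow> 'n paravector \<Rightarrow> 'n::{finite,linorder} clifford" where
  "cauchy_riemann f p = (1 / 2) *\<^sub>R
     (partial_derivative f (1, 0) p + (\<Sum>k\<in>UNIV. gen k * partial_derivative f (0, axis k 1) p))"

text \<open>
  Differentiability is demanded explicitly because \<^const>\<open>vector_derivative\<close> is total and carries
  no information where the derivative does not exist.
\<close>

definition monogenic :: "('n paravector \<Rightarrow> 'n::{finite,linorder} clifford) \<Rightarrow> bool" where
  "monogenic f \<longleftrightarrow> (\<forall>p. f differentiable (at p) \<and> cauchy_riemann f p = 0)"

section \<open>The vector of polynomials\<close>

text \<open>Entrywise sum of the exponential series of a square matrix.\<close>

definition mat_exp :: "real mat \<Rightarrow> real mat" where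
  "mat_exp A = Matrix.mat (dim_row A) (dim_row A) (\<lambda>ij. \<Sum>s. (A ^\<^sub>m s) $$ ij / fact s)"

definition creation_mat :: "nat \<Rightarrow> real mat" where
  "creation_mat m = Matrix.mat (m + 1) (m + 1) (\<lambda>(i, j). if i = j + 1 then real i else 0)"

definition phi :: "nat \<Rightarrow> (nat \<Rightarrow> real) \<Rightarrow> 'n paravector \<Rightarrow> 'n::{finite,linorder} clifford Matrix.vec" where
  "phi m c = (\<lambda>(x\<^sub>0, v). map_mat of_real (mat_exp (x\<^sub>0 \<cdot>\<^sub>m creation_mat m) * mat_diag (m + 1) c)
     *\<^sub>v Matrix.vec (m + 1) (\<lambda>j. vector_part v ^ j))"

lemma creation_mat_carrier: "x \<cdot>\<^sub>m creation_mat m \<in> carrier_mat (m + 1) (m + 1)"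
  by (simp add: creation_mat_def)

lemma creation_mat_pow:
  assumes "i \<le> m" "j \<le> m"
  shows "((x \<cdot>\<^sub>m creation_mat m) ^\<^sub>m s) $$ (i, j) =
    (if i = j + s then x ^ s * fact i / fact j else 0)"
  using assms
proof (induction s arbitrary: j)
  case 0
  then show ?case by (auto simp: creation_mat_def)
next
  case (Suc s)
  let ?H = "x \<cdot>\<^sub>m creation_mat m"
  note H = creation_mat_carrier[of x m]
  have entry: "?H $$ (l, j) = (if l = j + 1 then x * real l else 0)" if "l \<le> m" for l
    using that Suc.prems by (simp add: creation_mat_def)
  have "(?H ^\<^sub>m Suc s) $$ (i, j) = (\<Sum>l<m + 1. (?H ^\<^sub>m s) $$ (i, l) * ?H $$ (l, j))"
    using carrier_matD[OF H] Suc.prems carrier_matD[OF pow_carrier_mat[OF H, of s]]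
    by (simp add: scalar_prod_def lessThan_atLeast0 del: sum.op_ivl_Suc pow_mat_dim index_smult_mat)
  also have "\<dots> = (\<Sum>l<m + 1. if l = j + 1 then (if i = j + 1 + s then
      x ^ Suc s * fact i / fact j else 0) else 0)"
    using Suc.prems
    by (intro sum.cong refl) (auto simp: Suc.IH entry divide_simps)
  also have "\<dots> = (if i = j + Suc s then x ^ Suc s * fact i / fact j else 0)"
    using Suc.prems by (simp add: sum.delta)
  finally show ?case .
qed

lemma mat_exp_creation_mat:
  assumes "i \<le> m" "j \<le> m"
  shows "mat_exp (x \<cdot>\<^sub>m creation_mat m) $$ (i, j) =
    (if j \<le> i then real (i choose j) * x ^ (i - j) else 0)"
proof -
  have "mat_exp (x \<cdot>\<^sub>m creation_mat m) $$ (i, j) =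
      (\<Sum>s. (if i = j + s then x ^ s * fact i / fact j else 0) / fact s)"
    using assms carrier_matD[OF creation_mat_carrier[of x m]]
    by (simp add: mat_exp_def creation_mat_pow)
  also have "\<dots> = (\<Sum>s\<in>{i - j}. (if i = j + s then x ^ s * fact i / fact j else 0) / fact s)"
    by (rule suminf_finite) auto
  also have "\<dots> = (if j \<le> i then real (i choose j) * x ^ (i - j) else 0)"
    by (auto simp: binomial_fact)
  finally show ?thesis .
qed

lemma phi_nth:
  assumes "k \<le> m"
  shows "phi m c (x\<^sub>0, v) $v k =
    (\<Sum>j\<le>k. (real (k choose j) * c j * x\<^sub>0 ^ (k - j)) *\<^sub>R vector_part v ^ j)"
proof -
  let ?E = "mat_exp (x\<^sub>0 \<cdot>\<^sub>m creation_mat m)"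
  have E: "?E \<in> carrier_mat (Suc m) (Suc m)" 
    using carrier_matD[OF creation_mat_carrier[of x\<^sub>0 m]] by (simp add: mat_exp_def)
  have "phi m c (x\<^sub>0, v) $v k =
      (\<Sum>j<m + 1. of_real (?E $$ (k, j) * c j) * vector_part v ^ j)"
    using carrier_matD[OF E] assms
    by (simp add: phi_def mat_diag_mult_right[OF E] scalar_prod_def lessThan_atLeast0
        del: sum.op_ivl_Suc)
  also have "\<dots> = (\<Sum>j\<in>{..m}. of_real ((if j \<le> k then real (k choose j) * x\<^sub>0 ^ (k - j) else 0) * c j)
      * vector_part v ^ j)"
    using assms by (intro sum.cong) (auto simp: mat_exp_creation_mat)
  also have "\<dots> = (\<Sum>j\<le>k. of_real ((if j \<le> k then real (k choose j) * x\<^sub>0 ^ (k - j) else 0) * c j)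
      * vector_part v ^ j)"
    using assms by (intro sum.mono_neutral_right) auto
  also have "\<dots> = (\<Sum>j\<le>k. (real (k choose j) * c j * x\<^sub>0 ^ (k - j)) *\<^sub>R vector_part v ^ j)"
    by (intro sum.cong refl) (simp add: scaleR_conv_of_real mult_ac)
  finally show ?thesis .
qed

fun double_fact :: "nat \<Rightarrow> nat" where
  "double_fact 0 = 1"
| "double_fact (Suc 0) = 1"
| "double_fact (Suc (Suc k)) = Suc (Suc k) * double_fact k"

end

theory Submission
  imports Defs
begin

text \<open>
  Write \<open>X\<close> for \<open>vector_part v\<close>. The Clifford relations give $X^2 = -|v|^2$, a real scalar, so
  $X^{j+2} = -|v|^2 X^j$ and the product rule computes the action of the Dirac operator
  $\partial_{\underline{x}} = \sum_k e_k \partial_k$ on powers by induction in steps of two: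
  $\partial_{\underline{x}} X^j = -w_j X^{j-1}$, where $w_j = j$ for even $j$ and
  $w_j = n + j - 1$ for odd $j$ (\<open>vector_part_power_dirac\<close>). In
  $(\partial_0 + \partial_{\underline{x}}) \phi_k$ the coefficient of $X^j x_0^{k-j-1}$ is therefore
  $\binom{k}{j} (k-j) c_j - \binom{k}{j+1} w_{j+1} c_{j+1}$. Since
  $\binom{k}{j} (k-j) = \binom{k}{j+1} (j+1)$, all these coefficients vanish as soon as
  $w_{j+1} c_{j+1} = (j+1) c_j$ (\<open>appell_sum_monogenic\<close>). The double factorials are exactly the
  solution of this recursion: at even $j+1$ it says that consecutive coefficients agree, at odd
  $j+1 = 2i+1$ it says that $c_{2i+1} / c_{2i} = (2i+1) / (n+2i)$.
\<close>

section \<open>Powers of vectors in the Clifford algebra\<close>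

lemma linear_vector_part: "linear (vector_part :: real ^ 'n \<Rightarrow> 'n::finite clifford)"
  by (rule linearI)
    (simp_all add: vector_part_def scaleR_add_left sum.distrib scaleR_sum_right)

lemma vector_part_axis: "vector_part (axis k 1) = gen k"
proof -
  have "vector_part (axis k 1) = (\<Sum>i\<in>UNIV. if i = k then gen k else 0)"
    unfolding vector_part_def by (intro sum.cong refl) (auto simp: axis_def)
  then show ?thesis by simp
qed

lemma gen_squared: "gen k * gen k = (- 1 :: 'n::{finite,linorder} clifford)"
proof -
  have "2 *\<^sub>R (gen k * gen k) = 2 *\<^sub>R (- 1 :: 'n clifford)"
    using gen_anticommute[of k k] by (simp add: scaleR_2)
  then show ?thesis by (simp only: scaleR_cancel_left) simp
qed

text \<open>
  In the double sum for $X^2$ the off-diagonal terms cancel in pairs by anticommutativity, which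
  becomes visible after adding the sum to its transpose.
\<close>

lemma vector_part_squared:
  fixes v :: "real ^ 'n::{finite,linorder}"
  shows "vector_part v * vector_part v = - of_real (inner v v)"
proof -
  let ?f = "\<lambda>i j. (v $h i * v $h j) *\<^sub>R (gen i * gen j)"
  have S: "vector_part v * vector_part v = (\<Sum>i\<in>UNIV. \<Sum>j\<in>UNIV. ?f i j)"
    by (simp add: vector_part_def sum_product mult.commute)
  have "2 *\<^sub>R (vector_part v * vector_part v) =
      (\<Sum>i\<in>UNIV. \<Sum>j\<in>UNIV. ?f i j) + (\<Sum>i\<in>UNIV. \<Sum>j\<in>UNIV. ?f j i)"
    unfolding scaleR_2 S by (rule arg_cong2[where f = "(+)"]) (rule refl sum.swap)+
  also have "\<dots> = (\<Sum>i\<in>UNIV. \<Sum>j\<in>UNIV. (v $h i * v $h j) *\<^sub>R (gen i * gen j + gen j * gen i))"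
    unfolding sum.distrib[symmetric]
    by (intro sum.cong refl) (simp add: scaleR_add_right mult.commute)
  also have "\<dots> = (\<Sum>i\<in>UNIV. \<Sum>j\<in>UNIV. if i = j then 2 *\<^sub>R (- of_real (v $h i * v $h i)) else 0)"
    by (intro sum.cong refl) (simp add: gen_anticommute scaleR_conv_of_real mult_2 mult_2_right
        distrib_left)
  also have "\<dots> = 2 *\<^sub>R (- of_real (inner v v))"
    by (simp add: inner_vec_def scaleR_sum_right sum_negf)
  finally show ?thesis by (simp only: scaleR_cancel_left) simp
qed

lemma vector_part_power_add2:
  fixes v :: "real ^ 'n::{finite,linorder}"
  shows "vector_part v ^ (j + 2) = - (inner v v) *\<^sub>R vector_part v ^ j"
  by (simp add: power_add power2_eq_square vector_part_squared mult.commute scaleR_conv_of_real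
      flip: mult.assoc)

section \<open>The Dirac operator on powers\<close>

text \<open>
  Because $X^2 = -|v|^2$ is a scalar, it commutes with every $e_k$. Differentiating
  $X^{j+2} = -|v|^2 X^j$ thus produces $-|v|^2$ times the result for $X^j$, plus
  $\sum_k e_k (-2 v_k) X^j = -2 X^{j+1}$, so the weight grows by 2 when the exponent does. The
  dimension enters through $X^1$ alone, where $\sum_k e_k e_k = -n$.

  The derivative \<open>D\<close> is kept abstract: only its existence and the value of the Dirac operator
  $\sum_k e_k D(e_k)$ matter.
\<close>

lemma vector_part_power_dirac:
  fixes v :: "real ^ 'n::{finite,linorder}"
  shows "\<exists>D. ((\<lambda>v. vector_part v ^ j) has_derivative D) (at v) \<and>
    (\<Sum>k\<in>UNIV. gen k * D (axis k 1)) =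
      - (real (if even j then j else CARD('n) + j - 1) *\<^sub>R vector_part v ^ (j - 1))"
proof (induction j rule: induct_nat_012)
  case 0
  show ?case by (rule exI[of _ "\<lambda>h. 0"]) simp
next
  case 1
  have "(vector_part has_derivative vector_part) (at v)"
    by (intro bounded_linear_imp_has_derivative linear_linear[THEN iffD2] linear_vector_part)
  then show ?case
    by (intro exI[of _ vector_part])
      (simp add: vector_part_axis gen_squared sum_negf scaleR_conv_of_real)
next
  case (ge2 j)
  let ?X = "vector_part v" and ?w = "\<lambda>j. real (if even j then j else CARD('n) + j - 1)"
  obtain D where D: "((\<lambda>v. vector_part v ^ j) has_derivative D) (at v)"
    and dirac: "(\<Sum>k\<in>UNIV. gen k * D (axis k 1)) = - (?w j *\<^sub>R ?X ^ (j - 1))"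
    using ge2.IH(1) by blast
  let ?E = "\<lambda>h. (- inner v v) *\<^sub>R D h + (- (2 * inner v h)) *\<^sub>R ?X ^ j"
  have "((\<lambda>v. (- inner v v) *\<^sub>R vector_part v ^ j) has_derivative ?E) (at v)"
    by (rule derivative_eq_intros D refl | simp add: inner_commute)+
  then have E: "((\<lambda>v. vector_part v ^ (j + 2)) has_derivative ?E) (at v)"
    by (simp only: vector_part_power_add2)
  have "(\<Sum>k\<in>UNIV. gen k * ?E (axis k 1)) =
      (- inner v v) *\<^sub>R (\<Sum>k\<in>UNIV. gen k * D (axis k 1)) - 2 *\<^sub>R (?X * ?X ^ j)"
    by (simp add: vector_part_def inner_axis right_diff_distrib scaleR_sum_right
        sum_distrib_right sum_negf sum_subtractf)
  also have "\<dots> = - (?w j *\<^sub>R ((- inner v v) *\<^sub>R ?X ^ (j - 1))) - 2 *\<^sub>R ?X ^ (j + 1)"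
    by (simp add: dirac)
  \<comment> \<open>For \<open>j = 0\<close> the exponent \<open>j - 1\<close> is truncated, and both sides vanish with the weight.\<close>
  also have "?w j *\<^sub>R ((- inner v v) *\<^sub>R ?X ^ (j - 1)) = ?w j *\<^sub>R ?X ^ (j + 1)"
  proof (cases j)
    case (Suc i)
    then show ?thesis using vector_part_power_add2[of v i] by simp
  qed simp
  also have "- (?w j *\<^sub>R ?X ^ (j + 1)) - 2 *\<^sub>R ?X ^ (j + 1) = - ((?w j + 2) *\<^sub>R ?X ^ (j + 1))"
    by (simp add: scaleR_add_left)
  also have "?w j + 2 = ?w (j + 2)"
    by (cases j) auto
  finally show ?case using E by (intro exI[of _ ?E]) simp
qed

section \<open>Monogenic polynomials of Appell type\<close>

lemma partial_derivative_eq: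
  assumes "(f has_derivative D) (at p)"
  shows "partial_derivative f d p = D d"
proof -
  have "((\<lambda>t. f (p + t *\<^sub>R d)) has_derivative (\<lambda>t. D (t *\<^sub>R d))) (at 0)"
    by (rule has_derivative_compose[of "\<lambda>t. p + t *\<^sub>R d" "\<lambda>t. t *\<^sub>R d" 0 UNIV f D])
      (use assms in \<open>auto intro!: derivative_eq_intros\<close>)
  moreover have "D (t *\<^sub>R d) = t *\<^sub>R D d" for t
    using assms by (intro linear_scale has_derivative_linear)
  ultimately show ?thesis
    unfolding partial_derivative_def
    by (intro vector_derivative_at) (simp add: has_vector_derivative_def)
qed

lemma cauchy_riemann_eq:
  assumes "(f has_derivative D) (at p)"
  shows "cauchy_riemann f p = (1 / 2) *\<^sub>R (D (1, 0) + (\<Sum>k\<in>UNIV. gen k * D (0, axis k 1)))"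
  by (simp add: cauchy_riemann_def partial_derivative_eq[OF assms])

text \<open>
  Applying $\partial_0$ leaves the indices \<open>j < k\<close>, applying the Dirac operator leaves the indices
  \<open>1 \<le> j \<le> k\<close> and lowers the power of \<open>X\<close> by one. After shifting the second sum the two match
  term by term, with opposite signs.
\<close>

lemma appell_sum_monogenic:
  fixes c :: "nat \<Rightarrow> real"
  assumes rec: "\<And>j. j < k \<Longrightarrow>
    real (if even (Suc j) then Suc j else CARD('n::{finite,linorder}) + j) * c (Suc j)
      = real (Suc j) * c j"
  shows "monogenic (\<lambda>p :: 'n paravector.
    \<Sum>j\<le>k. (real (k choose j) * c j * fst p ^ (k - j)) *\<^sub>R vector_part (snd p) ^ j)"
    (is "monogenic ?F")
  unfolding monogenic_def
proof (intro allI)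
  fix p :: "'n paravector"
  obtain x v where p: "p = (x, v)" by (cases p)
  let ?X = "vector_part v" and ?w = "\<lambda>j. real (if even j then j else CARD('n) + j - 1)"
  let ?a = "\<lambda>j. real (k choose j) * c j"
  have "\<exists>D. \<forall>j. ((\<lambda>v. vector_part v ^ j) has_derivative D j) (at v) \<and>
      (\<Sum>i\<in>UNIV. gen i * D j (axis i 1)) = - (?w j *\<^sub>R ?X ^ (j - 1))"
    by (intro choice allI vector_part_power_dirac)
  then obtain D where D: "\<And>j. ((\<lambda>v. vector_part v ^ j) has_derivative D j) (at v)"
    and dirac: "\<And>j. (\<Sum>i\<in>UNIV. gen i * D j (axis i 1)) = - (?w j *\<^sub>R ?X ^ (j - 1))"
    by blast
  have Dsnd: "((\<lambda>p. vector_part (snd p) ^ j) has_derivative (\<lambda>h. D j (snd h))) (at p)" for j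
    by (rule has_derivative_compose[of snd snd p UNIV "\<lambda>v. vector_part v ^ j" "D j"])
      (auto simp: p D intro!: derivative_eq_intros)
  let ?G = "\<lambda>h. \<Sum>j\<le>k. (?a j * x ^ (k - j)) *\<^sub>R D j (snd h) +
      (?a j * (real (k - j) * fst h * x ^ (k - j - 1))) *\<^sub>R ?X ^ j"
  have G: "(?F has_derivative ?G) (at p)"
    by (rule derivative_eq_intros Dsnd refl | simp add: p)+
  have D0: "D j 0 = 0" for j
    using D by (intro linear_0 has_derivative_linear)
  have "?G (1, 0) = (\<Sum>j\<le>k. (?a j * real (k - j) * x ^ (k - j - 1)) *\<^sub>R ?X ^ j)"
    by (simp add: D0 mult_ac)
  also have "\<dots> = (\<Sum>j<k. (?a j * real (k - j) * x ^ (k - j - 1)) *\<^sub>R ?X ^ j)"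
    by (rule sum.mono_neutral_right) auto
  finally have t: "?G (1, 0) = \<dots>" .
  have "(\<Sum>i\<in>UNIV. gen i * ?G (0, axis i 1)) =
      (\<Sum>j\<le>k. \<Sum>i\<in>UNIV. (?a j * x ^ (k - j)) *\<^sub>R (gen i * D j (axis i 1)))"
    by (subst sum.swap) (simp add: sum_distrib_left)
  also have "\<dots> = (\<Sum>j\<le>k. - ((?a j * x ^ (k - j) * ?w j) *\<^sub>R ?X ^ (j - 1)))"
    by (simp add: dirac flip: scaleR_sum_right)
  also have "\<dots> = (\<Sum>j<k. - ((?a (Suc j) * x ^ (k - Suc j) * ?w (Suc j)) *\<^sub>R ?X ^ j))"
    by (simp add: sum.atMost_shift)
  also have "\<dots> = (\<Sum>j<k. - ((?a j * real (k - j) * x ^ (k - j - 1)) *\<^sub>R ?X ^ j))"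
  proof (intro sum.cong refl)
    fix j assume "j \<in> {..<k}"
    then have j: "j < k" by simp
    have absorb: "real (k choose Suc j) * real (Suc j) = real (k choose j) * real (k - j)"
      using j by (simp only: flip: of_nat_mult)
        (metis binomial_absorb_comp binomial_absorption mult.commute)
    have "c (Suc j) * ?w (Suc j) = real (Suc j) * c j"
      using rec[OF j] by (subst mult.commute) (simp only: add_Suc_right diff_Suc_1)
    then have "?a (Suc j) * ?w (Suc j) = real (k choose Suc j) * real (Suc j) * c j"
      by (simp only: mult.assoc)
    also have "\<dots> = ?a j * real (k - j)"
      by (subst absorb) (simp only: mult_ac)
    finally have coeff: "?a (Suc j) * ?w (Suc j) = ?a j * real (k - j)" .
    have "?a (Suc j) * x ^ (k - Suc j) * ?w (Suc j) = ?a (Suc j) * ?w (Suc j) * x ^ (k - Suc j)"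
      by (simp only: mult_ac)
    also have "\<dots> = ?a j * real (k - j) * x ^ (k - j - 1)"
      by (subst coeff) simp
    finally
    show "- ((?a (Suc j) * x ^ (k - Suc j) * ?w (Suc j)) *\<^sub>R ?X ^ j) =
        - ((?a j * real (k - j) * x ^ (k - j - 1)) *\<^sub>R ?X ^ j)"
      by (simp only:)
  qed
  finally have "?G (1, 0) + (\<Sum>i\<in>UNIV. gen i * ?G (0, axis i 1)) = 0"
    by (simp only: t sum_negf) simp
  then have "cauchy_riemann ?F p = 0"
    by (simp only: cauchy_riemann_eq[OF G]) simp
  then show "?F differentiable (at p) \<and> cauchy_riemann ?F p = 0"
    using G by (auto simp: differentiable_def)
qed

section \<open>The double factorial coefficients\<close>

lemma double_fact_pos: "double_fact k > 0"
  by (induction k rule: double_fact.induct) auto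

text \<open>
  Passing from $i$ to $i+1$ multiplies the numerator by $2i+1$ and the denominator by $n+2i$, the
  weight of the odd power $X^{2i+1}$.
\<close>

lemma double_fact_ratio_step:
  assumes "n > 1"
  shows "real (n + 2 * i) * (real (double_fact (2 * i + 1) * double_fact (n - 2))
      / real (double_fact (n + 2 * i))) =
    real (2 * i + 1) * (real (double_fact (2 * i - 1) * double_fact (n - 2))
      / real (double_fact (n + 2 * i - 2)))"
proof -
  obtain l where l: "n = Suc (Suc l)" using assms by (metis less_imp_Suc_add plus_1_eq_Suc)
  have a: "double_fact (n + 2 * i) = (n + 2 * i) * double_fact (n + 2 * i - 2)"
    by (simp add: l)
  \<comment> \<open>For \<open>i = 0\<close> truncated subtraction gives \<open>double_fact 0 = 1\<close>, the conventional value of $(-1)!!$.\<close>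
  have b: "double_fact (2 * i + 1) = (2 * i + 1) * double_fact (2 * i - 1)"
    by (cases i) auto
  have "real (n + 2 * i) \<noteq> 0" "real (double_fact (n + 2 * i - 2)) \<noteq> 0"
    using assms double_fact_pos[of "n + 2 * i - 2"] by auto
  then show ?thesis
    unfolding a b of_nat_mult by (simp only: divide_simps mult_ac) simp
qed

theorem theorem3p1:
  fixes c :: "nat \<Rightarrow> real" and n m :: nat
  assumes "n = CARD('n::{finite,linorder})" and "n > 1"
    and "c 0 \<noteq> 0"
    and "\<And>k. k \<ge> 1 \<Longrightarrow> 2 * k \<le> m \<Longrightarrow>
      c (2 * k) = real (double_fact (2 * k - 1) * double_fact (n - 2))
        / real (double_fact (n + 2 * k - 2)) * c 0"
    and "\<And>k. k \<ge> 1 \<Longrightarrow> 2 * k - 1 \<le> m \<Longrightarrow>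
      c (2 * k - 1) = real (double_fact (2 * k - 1) * double_fact (n - 2))
        / real (double_fact (n + 2 * k - 2)) * c 0"
  shows "\<forall>k\<le>m. monogenic (\<lambda>x :: 'n paravector. phi m c x $v k)"
proof (intro allI impI)
  fix k assume k: "k \<le> m"
  let ?q = "\<lambda>i. real (double_fact (2 * i - 1) * double_fact (n - 2))
    / real (double_fact (n + 2 * i - 2))"
  have even_coeff: "c (2 * i) = ?q i * c 0" if "2 * i \<le> m" for i
    using assms(4)[of i] that double_fact_pos[of "n - 2"] by (cases "i = 0") auto
  have odd_coeff: "c (2 * i + 1) = ?q (Suc i) * c 0" if "2 * i + 1 \<le> m" for i
    using assms(5)[of "Suc i"] that by simp
  have rec: "real (if even (Suc j) then Suc j else CARD('n) + j) * c (Suc j) = real (Suc j) * c j"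
    if "j < k" for j
  proof (cases "even j")
    case True
    then obtain i where i: "j = 2 * i" by blast
    have "c (2 * i + 1) = real (double_fact (2 * i + 1) * double_fact (n - 2))
        / real (double_fact (n + 2 * i)) * c 0"
      using odd_coeff[of i] that k i by simp
    then have "real (n + 2 * i) * c (2 * i + 1) = real (2 * i + 1) * c (2 * i)"
      using even_coeff[of i] that k i
      by (simp only: double_fact_ratio_step[OF assms(2)] flip: mult.assoc)
    then show ?thesis using i assms(1) by simp
  next
    case False
    then obtain i where i: "j = 2 * i + 1" by (elim oddE)
    then have "c (Suc j) = c j"
      using odd_coeff[of i] even_coeff[of "Suc i"] that k by simp
    then show ?thesis using False by simp
  qed
  have "(\<lambda>x :: 'n paravector. phi m c x $v k) = (\<lambda>x.
      \<Sum>j\<le>k. (real (k choose j) * c j * fst x ^ (k - j)) *\<^sub>R vector_part (snd x) ^ j)"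
    using phi_nth[OF k, of c] by (auto simp: fun_eq_iff)
  then show "monogenic (\<lambda>x :: 'n paravector. phi m c x $v k)"
    using appell_sum_monogenic[OF rec] by simp
qed

end
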